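(* Let $(\mathcal C,U)$ be a UD-category. Every noninitial object of $\mathcal C$ is uniquely decomposable.
   Context: A concrete category over the category $\mathrm{Set}$ of sets is a pair $(\mathcal C,U)$, where $\mathcal C$ is a category and $U:\mathcal C\to \mathrm{Set}$ is a faithful functor. $\mathcal C$ is coproduct complete if it has coproducts of all families of objects; it is balanced if every morphism that is both a monomorphism and an epimorphism is an isomorphism. A subobject of an object $A$ is a pair $(S,\nu)$ with $\nu:S\to A$ a monomorphism. In a coproduct complete category with initial object $\theta\cong\coprod\emptyset$, an object is indecomposable if it is not isomorphic to an initial object nor to a coproduct of two non-initial objects. A concrete category $(\mathcal C,U)$ over $\mathrm{Set}$ is a UD-category if: (UD1) $\mathcal C$ is a coproduct complete balanced category with an initial object $\theta\cong\coprod\emptyset$, for which each morphism $\theta\to A$ is a monomorphism and there is at most one morphism $A\to\theta$, for every object $A$; (UD2) for any morphism $f:A\to B$ there exists a subobject $(A^f,\iota)$ of $B$ such that $U(A^f)=U(f)(U(A))\subseteq U(B)$ and $U(\iota)$ is the subset inclusion map; (UD3) for each morphism $f:A\to B$ and every subobject $(S,\nu)$ of $B$ with $U(f)(U(A))\subseteq U(\nu)(U(S))$ there exists a morphism $g:A\to S$ with $f=\nu g$; (UD4) for every nonempty family $(A_i,\nu_i)_{i\in I}$ of subobjects of an object $A$ there exist subobjects $(\bigcap_i A_i^{\nu_i},\iota_\cap)$ and $(\bigcup_i A_i^{\nu_i},\iota_\cup)$ of $A$ such that $U(\bigcap_i A_i^{\nu_i})=\bigcap_i U(\nu_i)(U(A_i))=\bigcap_i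 U(A_i^{\nu_i})$, $U(\bigcup_i A_i^{\nu_i})=\bigcup_i U(\nu_i)(U(A_i))=\bigcup_i U(A_i^{\nu_i})$ and $U(\iota_\cap),U(\iota_\cup)$ are the subset inclusion maps; (UD5) if $(A,(\nu_0,\nu_1))$ is a coproduct of a pair of objects $(A_0,A_1)$, then $\nu_0,\nu_1$ are monomorphisms and $A_0^{\nu_0}\cap A_1^{\nu_1}$ is isomorphic to $\theta$; (UD6) for every noninitial object $A$ and every $x\in U(A)$ there exists an indecomposable subobject $(B,\nu)$ of $A$ such that $x\in U(\nu)(U(B))$. An object $A$ is uniquely decomposable if there exists a family of indecomposable objects $(A_j, j\in J)$ such that $A\cong\coprod_{j\in J}A_j$, and for each family of indecomposable objects $(\tilde A_j, j\in\tilde J)$ with $A\cong\coprod_{j\in\tilde J}\tilde A_j$ there exists a bijection $b:J\to\tilde J$ such that $A_j\cong\tilde A_{b(j)}$ for each $j\in J$. *)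

theory Defs
  imports "HOL-Library.FuncSet"
begin

section \<open>Categories and functors\<close>

record ('o, 'm) cat =
  Obj :: "'o set"
  Arr :: "'m set"
  Dom :: "'m \<Rightarrow> 'o"
  Cod :: "'m \<Rightarrow> 'o"
  Id :: "'o \<Rightarrow> 'm"
  Comp :: "'m \<Rightarrow> 'm \<Rightarrow> 'm"

text \<open>\<open>Comp C g f\<close> is the composite \<open>g f\<close> (first \<open>f\<close>, then \<open>g\<close>);
  it is constrained only when \<open>Dom C g = Cod C f\<close>.\<close>

definition hom :: "('o, 'm, 'z) cat_scheme \<Rightarrow> 'o \<Rightarrow> 'o \<Rightarrow> 'm set" where
  "hom C A B = {f \<in> Arr C. Dom C f = A \<and> Cod C f = B}"

locale category =
  fixes C :: "('o, 'm, 'z) cat_scheme"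
  assumes dom_in_Obj: "f \<in> Arr C \<Longrightarrow> Dom C f \<in> Obj C"
    and cod_in_Obj: "f \<in> Arr C \<Longrightarrow> Cod C f \<in> Obj C"
    and Id_in_hom: "A \<in> Obj C \<Longrightarrow> Id C A \<in> hom C A A"
    and Comp_in_hom: "f \<in> hom C A B \<Longrightarrow> g \<in> hom C B D \<Longrightarrow> Comp C g f \<in> hom C A D"
    and Comp_Id_right: "f \<in> hom C A B \<Longrightarrow> Comp C f (Id C A) = f"
    and Comp_Id_left: "f \<in> hom C A B \<Longrightarrow> Comp C (Id C B) f = f"
    and Comp_assoc: "f \<in> hom C A B \<Longrightarrow> g \<in> hom C B D \<Longrightarrow> h \<in> hom C D E \<Longrightarrow>
      Comp C h (Comp C g f) = Comp C (Comp C h g) f"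

record ('o, 'm, 'p, 'n) ftor =
  on_obj :: "'o \<Rightarrow> 'p"
  on_arr :: "'m \<Rightarrow> 'n"

locale is_ftor = source: category C + target: category D
  for C :: "('o, 'm, 'y) cat_scheme" and D :: "('p, 'n, 'z) cat_scheme" +
  fixes F :: "('o, 'm, 'p, 'n) ftor"
  assumes on_obj_in_Obj: "A \<in> Obj C \<Longrightarrow> on_obj F A \<in> Obj D"
    and on_arr_in_hom: "f \<in> hom C A B \<Longrightarrow> on_arr F f \<in> hom D (on_obj F A) (on_obj F B)"
    and on_arr_Id: "A \<in> Obj C \<Longrightarrow> on_arr F (Id C A) = Id D (on_obj F A)"
    and on_arr_Comp: "f \<in> hom C A B \<Longrightarrow> g \<in> hom C B E \<Longrightarrow>
      on_arr F (Comp C g f) = Comp D (on_arr F g) (on_arr F f)"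

locale is_faithful_ftor = is_ftor +
  assumes faithful: "f \<in> hom C A B \<Longrightarrow> g \<in> hom C A B \<Longrightarrow> on_arr F f = on_arr F g \<Longrightarrow> f = g"

definition mono_arr :: "('o, 'm, 'z) cat_scheme \<Rightarrow> 'm \<Rightarrow> bool" where
  "mono_arr C m \<longleftrightarrow> m \<in> Arr C \<and>
    (\<forall>A. \<forall>f \<in> hom C A (Dom C m). \<forall>g \<in> hom C A (Dom C m). Comp C m f = Comp C m g \<longrightarrow> f = g)"

definition epi_arr :: "('o, 'm, 'z) cat_scheme \<Rightarrow> 'm \<Rightarrow> bool" where
  "epi_arr C e \<longleftrightarrow> e \<in> Arr C \<and>
    (\<forall>B. \<forall>f \<in> hom C (Cod C e) B. \<forall>g \<in> hom C (Cod C e) B. Comp C f e = Comp C g e \<longrightarrow> f = g)"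

definition iso_arr :: "('o, 'm, 'z) cat_scheme \<Rightarrow> 'm \<Rightarrow> bool" where
  "iso_arr C f \<longleftrightarrow> f \<in> Arr C \<and>
    (\<exists>g \<in> hom C (Cod C f) (Dom C f).
      Comp C g f = Id C (Dom C f) \<and> Comp C f g = Id C (Cod C f))"

definition isomorphic :: "('o, 'm, 'z) cat_scheme \<Rightarrow> 'o \<Rightarrow> 'o \<Rightarrow> bool" where
  "isomorphic C A B \<longleftrightarrow> (\<exists>f \<in> hom C A B. iso_arr C f)"

definition balanced :: "('o, 'm, 'z) cat_scheme \<Rightarrow> bool" where
  "balanced C \<longleftrightarrow> (\<forall>f. mono_arr C f \<and> epi_arr C f \<longrightarrow> iso_arr C f)"

definition subobject :: "('o, 'm, 'z) cat_scheme \<Rightarrow> 'o \<Rightarrow> 'o \<Rightarrow> 'm \<Rightarrow> bool" where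
  "subobject C A S \<nu> \<longleftrightarrow> S \<in> Obj C \<and> \<nu> \<in> hom C S A \<and> mono_arr C \<nu>"

definition initial :: "('o, 'm, 'z) cat_scheme \<Rightarrow> 'o \<Rightarrow> bool" where
  "initial C T \<longleftrightarrow> T \<in> Obj C \<and> (\<forall>A \<in> Obj C. \<exists>!f. f \<in> hom C T A)"

definition noninitial :: "('o, 'm, 'z) cat_scheme \<Rightarrow> 'o \<Rightarrow> bool" where
  "noninitial C A \<longleftrightarrow> A \<in> Obj C \<and> \<not> initial C A"

definition is_coproduct ::
  "('o, 'm, 'z) cat_scheme \<Rightarrow> 'i set \<Rightarrow> ('i \<Rightarrow> 'o) \<Rightarrow> 'o \<Rightarrow> ('i \<Rightarrow> 'm) \<Rightarrow> bool" where
  "is_coproduct C I A X \<nu> \<longleftrightarrow> X \<in> Obj C \<and> (\<forall>i \<in> I. A i \<in> Obj C \<and> \<nu> i \<in> hom C (A i) X) \<and>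
    (\<forall>Y \<in> Obj C. \<forall>g. (\<forall>i \<in> I. g i \<in> hom C (A i) Y) \<longrightarrow>
      (\<exists>!h. h \<in> hom C X Y \<and> (\<forall>i \<in> I. Comp C h (\<nu> i) = g i)))"

text \<open>Coproducts of a pair are coproducts over the index type \<^typ>\<open>bool\<close>, with the
  member of index 0 at \<^term>\<open>True\<close> (the first argument of \<open>case_bool\<close>).\<close>

definition is_coproduct2 ::
  "('o, 'm, 'z) cat_scheme \<Rightarrow> 'o \<Rightarrow> 'o \<Rightarrow> 'o \<Rightarrow> 'm \<Rightarrow> 'm \<Rightarrow> bool" where
  "is_coproduct2 C A0 A1 X \<nu>0 \<nu>1 \<longleftrightarrow>
    is_coproduct C UNIV (case_bool A0 A1) X (case_bool \<nu>0 \<nu>1)"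

definition iso_to_coproduct ::
  "('o, 'm, 'z) cat_scheme \<Rightarrow> 'o \<Rightarrow> 'i set \<Rightarrow> ('i \<Rightarrow> 'o) \<Rightarrow> bool" where
  "iso_to_coproduct C A I F \<longleftrightarrow> (\<exists>X \<nu>. is_coproduct C I F X \<nu> \<and> isomorphic C A X)"

definition indecomposable :: "('o, 'm, 'z) cat_scheme \<Rightarrow> 'o \<Rightarrow> bool" where
  "indecomposable C A \<longleftrightarrow> A \<in> Obj C \<and>
    \<not> (\<exists>T. initial C T \<and> isomorphic C A T) \<and>
    \<not> (\<exists>B0 B1 X \<nu>0 \<nu>1. noninitial C B0 \<and> noninitial C B1 \<and>
        is_coproduct2 C B0 B1 X \<nu>0 \<nu>1 \<and> isomorphic C A X)"


section \<open>The category of sets\<close>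

text \<open>The sets of the theory are the members of a universe \<open>\<S>\<close> of (small) subsets of a
  type \<open>'u\<close>, which is a parameter: reading \<open>'u\<close> as the class of all sets and \<open>\<S>\<close> as the
  collection of its subclasses that are sets gives the usual category of sets.  Coproduct
  completeness cannot instead be required over all subsets of arbitrary types, because such a
  category would be a preorder.  Closure under power sets is not needed, and without it
  universes exist in HOL, for instance all subsets of an infinite type.\<close>

definition set_universe :: "'u set set \<Rightarrow> bool" where
  "set_universe \<S> \<longleftrightarrow>
    (\<exists>X \<in> \<S>. infinite X) \<and>
    (\<forall>X \<in> \<S>. \<forall>Y. Y \<subseteq> X \<longrightarrow> Y \<in> \<S>) \<and>
    (\<forall>X \<in> \<S>. \<forall>f :: 'u \<Rightarrow> 'u. f ` X \<in> \<S>) \<and>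
    (\<forall>I \<in> \<S>. \<forall>X :: 'u \<Rightarrow> 'u set. (\<forall>i \<in> I. X i \<in> \<S>) \<longrightarrow> (\<Union>i \<in> I. X i) \<in> \<S>)"

datatype 'u set_arrow = Set_Arrow (sdom: "'u set") (sfun: "'u \<Rightarrow> 'u") (scod: "'u set")

definition Set_cat :: "'u set set \<Rightarrow> ('u set, 'u set_arrow) cat" where
  "Set_cat \<S> =
    \<lparr>Obj = \<S>,
     Arr = {f. sdom f \<in> \<S> \<and> scod f \<in> \<S> \<and> sfun f \<in> sdom f \<rightarrow>\<^sub>E scod f},
     Dom = sdom,
     Cod = scod,
     Id = (\<lambda>X. Set_Arrow X (\<lambda>x\<in>X. x) X),
     Comp = (\<lambda>g f. Set_Arrow (sdom f) (compose (sdom f) (sfun g) (sfun f)) (scod g))\<rparr>"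

definition set_incl :: "'u set \<Rightarrow> 'u set \<Rightarrow> 'u set_arrow" where
  "set_incl X Y = Set_Arrow X (\<lambda>x\<in>X. x) Y"

lemma category_Set_cat: "category (Set_cat (\<S> :: 'u set set))"
proof
  fix X Y Z W and f g h :: "'u set_arrow"
  assume f: "f \<in> hom (Set_cat \<S>) X Y"
  show "Comp (Set_cat \<S>) f (Id (Set_cat \<S>) X) = f"
    using f by (intro set_arrow.expand)
      (auto simp: Set_cat_def hom_def compose_def restrict_def fun_eq_iff PiE_iff extensional_def)
  show "Comp (Set_cat \<S>) (Id (Set_cat \<S>) Y) f = f"
    using f by (intro set_arrow.expand)
      (auto simp: Set_cat_def hom_def compose_def restrict_def fun_eq_iff PiE_iff extensional_def)
  assume g: "g \<in> hom (Set_cat \<S>) Y Z"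
  show "Comp (Set_cat \<S>) g f \<in> hom (Set_cat \<S>) X Z"
    using f g by (auto simp: Set_cat_def hom_def compose_def PiE_iff)
  assume "h \<in> hom (Set_cat \<S>) Z W"
  then show "Comp (Set_cat \<S>) h (Comp (Set_cat \<S>) g f)
      = Comp (Set_cat \<S>) (Comp (Set_cat \<S>) h g) f"
    using f g by (auto simp: Set_cat_def hom_def compose_def restrict_def fun_eq_iff PiE_iff)
qed (auto simp: Set_cat_def hom_def)


section \<open>UD-categories\<close>

locale concrete_category = is_faithful_ftor C "Set_cat \<S>" U
  for \<S> :: "'u set set" and C :: "('o, 'm, 'z) cat_scheme"
    and U :: "('o, 'm, 'u set, 'u set_arrow) ftor" +
  assumes universe: "set_universe \<S>"

definition coproduct_complete :: "'u set set \<Rightarrow> ('o, 'm, 'z) cat_scheme \<Rightarrow> bool" where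
  "coproduct_complete \<S> C \<longleftrightarrow>
    (\<forall>I \<in> \<S>. \<forall>A. (\<forall>i \<in> I. A i \<in> Obj C) \<longrightarrow> (\<exists>X \<nu>. is_coproduct C I A X \<nu>))"

definition uimage :: "('o, 'm, 'u set, 'u set_arrow) ftor \<Rightarrow> 'o \<Rightarrow> 'm \<Rightarrow> 'u set" where
  "uimage U A f = sfun (on_arr U f) ` on_obj U A"

text \<open>A subobject carried by a subset of the underlying set, included by the subset inclusion.\<close>

definition incl_subobject ::
  "('o, 'm, 'z) cat_scheme \<Rightarrow> ('o, 'm, 'u set, 'u set_arrow) ftor \<Rightarrow> 'o \<Rightarrow> 'o \<Rightarrow> 'm \<Rightarrow> bool" where
  "incl_subobject C U A S \<iota> \<longleftrightarrow> subobject C A S \<iota> \<and>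
    on_obj U S \<subseteq> on_obj U A \<and> on_arr U \<iota> = set_incl (on_obj U S) (on_obj U A)"

text \<open>For a family of subobjects \<open>(S i, \<nu> i)\<close> of \<open>A\<close>.  The sets \<open>U(A_i^{\<nu>_i})\<close> in the usual
  notation are by definition the images \<open>uimage U (S i) (\<nu> i)\<close>.\<close>

definition is_intersection ::
  "('o, 'm, 'z) cat_scheme \<Rightarrow> ('o, 'm, 'u set, 'u set_arrow) ftor \<Rightarrow> 'o \<Rightarrow>
    'i set \<Rightarrow> ('i \<Rightarrow> 'o) \<Rightarrow> ('i \<Rightarrow> 'm) \<Rightarrow> 'o \<Rightarrow> 'm \<Rightarrow> bool" where
  "is_intersection C U A I S \<nu> T \<iota> \<longleftrightarrow>
    incl_subobject C U A T \<iota> \<and> on_obj U T = (\<Inter>i \<in> I. uimage U (S i) (\<nu> i))"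

definition is_union ::
  "('o, 'm, 'z) cat_scheme \<Rightarrow> ('o, 'm, 'u set, 'u set_arrow) ftor \<Rightarrow> 'o \<Rightarrow>
    'i set \<Rightarrow> ('i \<Rightarrow> 'o) \<Rightarrow> ('i \<Rightarrow> 'm) \<Rightarrow> 'o \<Rightarrow> 'm \<Rightarrow> bool" where
  "is_union C U A I S \<nu> T \<iota> \<longleftrightarrow>
    incl_subobject C U A T \<iota> \<and> on_obj U T = (\<Union>i \<in> I. uimage U (S i) (\<nu> i))"

text \<open>In \<open>UD5\<close>, intersections are determined only up to isomorphism, so the condition is
  imposed on every intersection; one exists by \<open>UD4\<close>.\<close>

locale UD_category = concrete_category \<S> C U
  for \<S> :: "'u set set" and C :: "('o, 'm, 'z) cat_scheme"
    and U :: "('o, 'm, 'u set, 'u set_arrow) ftor" +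
  assumes UD1_coproducts: "coproduct_complete \<S> C"
    and UD1_balanced: "balanced C"
    and UD1_initial: "\<exists>\<theta>. initial C \<theta> \<and> (\<exists>F. iso_to_coproduct C \<theta> ({} :: 'u set) F) \<and>
      (\<forall>B \<in> Obj C. (\<forall>f \<in> hom C \<theta> B. mono_arr C f) \<and>
        (\<forall>f \<in> hom C B \<theta>. \<forall>g \<in> hom C B \<theta>. f = g))"
    and UD2: "f \<in> hom C A B \<Longrightarrow>
      \<exists>S \<iota>. incl_subobject C U B S \<iota> \<and> on_obj U S = uimage U A f"
    and UD3: "f \<in> hom C A B \<Longrightarrow> subobject C B S \<nu> \<Longrightarrow> uimage U A f \<subseteq> uimage U S \<nu> \<Longrightarrow>
      \<exists>g \<in> hom C A S. f = Comp C \<nu> g"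
    and UD4: "A \<in> Obj C \<Longrightarrow> I \<in> \<S> \<Longrightarrow> I \<noteq> {} \<Longrightarrow> (\<And>i. i \<in> I \<Longrightarrow> subobject C A (F i) (\<mu> i)) \<Longrightarrow>
      (\<exists>T \<iota>. is_intersection C U A I F \<mu> T \<iota>) \<and> (\<exists>T \<iota>. is_union C U A I F \<mu> T \<iota>)"
    and UD5: "is_coproduct2 C A0 A1 X \<nu>0 \<nu>1 \<Longrightarrow>
      mono_arr C \<nu>0 \<and> mono_arr C \<nu>1 \<and>
      (\<forall>T \<iota>. is_intersection C U X UNIV (case_bool A0 A1) (case_bool \<nu>0 \<nu>1) T \<iota> \<longrightarrow>
        (\<exists>\<theta>. initial C \<theta> \<and> isomorphic C T \<theta>))"
    and UD6: "noninitial C A \<Longrightarrow> x \<in> on_obj U A \<Longrightarrow>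
      \<exists>B \<nu>. subobject C A B \<nu> \<and> indecomposable C B \<and> x \<in> uimage U B \<nu>"

definition uniquely_decomposable :: "'u set set \<Rightarrow> ('o, 'm, 'z) cat_scheme \<Rightarrow> 'o \<Rightarrow> bool" where
  "uniquely_decomposable \<S> C A \<longleftrightarrow> A \<in> Obj C \<and>
    (\<exists>J \<in> \<S>. \<exists>F.
      (\<forall>j \<in> J. indecomposable C (F j)) \<and> iso_to_coproduct C A J F \<and>
      (\<forall>J' \<in> \<S>. \<forall>F'.
        (\<forall>j \<in> J'. indecomposable C (F' j)) \<and> iso_to_coproduct C A J' F' \<longrightarrow>
        (\<exists>b. bij_betw b J J' \<and> (\<forall>j \<in> J. isomorphic C (F j) (F' (b j))))))"

end

theory Submission
  imports Defs
begin

text \<open>The faithful functor lets one compute in underlying sets. Balancedness together with the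
  image factorization of \<open>UD2\<close> and \<open>UD3\<close> makes the monomorphisms exactly the arrows with injective
  underlying map (\<open>inj_on_if_mono\<close>, \<open>mono_if_inj_on\<close>), so a subobject is determined up to isomorphism
  by the subset it covers, and bijective arrows are isomorphisms. The underlying set of the initial
  object may be nonempty, as for pointed sets; its image in \<open>A\<close> is the set \<open>trivial_pts A\<close>. Every
  subobject contains it, and the subobjects that contain nothing else are the initial ones.

  In this language a coproduct decomposition of \<open>A\<close> is a family of subobjects of \<open>A\<close> that covers the
  underlying set and whose members meet pairwise only in trivial points. That such a family is a coproduct is
  \<open>coproduct_if_cover\<close>; the converse is \<open>coproduct_cover\<close> and \<open>coproduct_piece\<close>, where \<open>UD5\<close> enters after
  all summands but one have been collected into a single object. Consequently a subobject of a binary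
  coproduct is the coproduct of its intersections with the two summands, and an indecomposable one
  lies inside a single summand (\<open>indecomposable_in_coproduct2\<close>).

  The rest resembles the splitting of a space into connected components. Indecomposable subobjects
  with a common nontrivial point have an indecomposable union (\<open>union_indecomposable\<close>), so lying in a
  common indecomposable subobject is an equivalence relation on nontrivial points. By \<open>UD6\<close> its
  classes, each enlarged by the trivial points, cover \<open>A\<close>; they are the pieces of a decomposition
  (\<open>decomposition_ex\<close>). Conversely, pieces of two decompositions that share a nontrivial point contain
  each other, so both decompositions consist of the same subsets of the underlying set
  (\<open>decomposition_unique\<close>).\<close>


section \<open>Small index sets\<close>

text \<open>Completeness and \<open>UD4\<close> speak of families indexed by members of \<open>\<S>\<close>, while binary coproducts
  are indexed by \<^typ>\<open>bool\<close>. Smallness up to bijection lets one argument serve both.\<close>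

definition small :: "'u set set \<Rightarrow> 'i set \<Rightarrow> bool" where
  "small \<S> I \<longleftrightarrow> (\<exists>J \<in> \<S>. \<exists>e. bij_betw e J I)"

lemma small_member: "I \<in> \<S> \<Longrightarrow> small \<S> I"
  unfolding small_def using bij_betw_id by blast

lemma small_bool:
  assumes "set_universe (\<S> :: 'u set set)"
  shows "small \<S> (UNIV :: bool set)"
proof -
  obtain X where X: "X \<in> \<S>" "infinite X"
    using assms by (auto simp: set_universe_def)
  obtain a where a: "a \<in> X" using X by (metis finite.emptyI equals0I)
  obtain b where b: "b \<in> X" "b \<noteq> a"
    using X by (metis finite.simps insertI1 finite_subset singletonI subsetI)
  have "{a, b} \<in> \<S>"
    using assms X a b unfolding set_universe_def by (metis empty_subsetI insert_subset)
  moreover have "bij_betw (\<lambda>u. u = a) {a, b} UNIV"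
    using b by (auto simp: bij_betw_def inj_on_def UNIV_bool)
  ultimately show ?thesis unfolding small_def by blast
qed


section \<open>Coproducts in a category\<close>

lemma is_coproduct_reindex:
  assumes X: "is_coproduct C I A X \<nu>" and e: "bij_betw e K I"
  shows "is_coproduct C K (\<lambda>k. A (e k)) X (\<lambda>k. \<nu> (e k))"
  unfolding is_coproduct_def
proof (intro conjI ballI allI impI)
  show "X \<in> Obj C" using X by (simp add: is_coproduct_def)
  fix k assume "k \<in> K"
  then have "e k \<in> I" using e by (auto simp: bij_betw_def)
  then show "A (e k) \<in> Obj C" "\<nu> (e k) \<in> hom C (A (e k)) X"
    using X by (auto simp: is_coproduct_def)
next
  fix Y g assume Y: "Y \<in> Obj C" and g: "\<forall>k\<in>K. g k \<in> hom C (A (e k)) Y"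
  define d where "d = inv_into K e"
  have ed: "\<And>i. i \<in> I \<Longrightarrow> d i \<in> K \<and> e (d i) = i" and de: "\<And>k. k \<in> K \<Longrightarrow> e k \<in> I \<and> d (e k) = k"
    using e unfolding d_def bij_betw_def by (auto intro: inv_into_into f_inv_into_f)
  have "\<forall>i\<in>I. g (d i) \<in> hom C (A i) Y" using g ed by metis
  then have "\<exists>!h. h \<in> hom C X Y \<and> (\<forall>i\<in>I. Comp C h (\<nu> i) = g (d i))"
    using X Y unfolding is_coproduct_def by simp
  moreover have "(\<forall>i\<in>I. Comp C h (\<nu> i) = g (d i)) \<longleftrightarrow> (\<forall>k\<in>K. Comp C h (\<nu> (e k)) = g k)" for h
    using ed de by metis
  ultimately show "\<exists>!h. h \<in> hom C X Y \<and> (\<forall>k\<in>K. Comp C h (\<nu> (e k)) = g k)" by simp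
qed

context category
begin

lemma hom_Obj: "f \<in> hom C A B \<Longrightarrow> A \<in> Obj C \<and> B \<in> Obj C"
  using dom_in_Obj cod_in_Obj by (auto simp: hom_def)

lemma hom_Arr: "f \<in> hom C A B \<Longrightarrow> f \<in> Arr C \<and> Dom C f = A \<and> Cod C f = B"
  by (auto simp: hom_def)

lemma iso_arr_hom_iff:
  "f \<in> hom C A B \<Longrightarrow>
    iso_arr C f \<longleftrightarrow> (\<exists>g \<in> hom C B A. Comp C g f = Id C A \<and> Comp C f g = Id C B)"
  using hom_Arr[of f A B] by (auto simp: iso_arr_def)

lemma isomorphicE:
  assumes "isomorphic C A B"
  obtains f g where "f \<in> hom C A B" "g \<in> hom C B A" "Comp C g f = Id C A" "Comp C f g = Id C B"
  using assms iso_arr_hom_iff unfolding isomorphic_def by metis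

lemma isomorphic_refl: "A \<in> Obj C \<Longrightarrow> isomorphic C A A"
  using Id_in_hom Comp_Id_left iso_arr_hom_iff unfolding isomorphic_def by metis

lemma isomorphic_sym: "isomorphic C A B \<Longrightarrow> isomorphic C B A"
  by (metis isomorphicE iso_arr_hom_iff isomorphic_def)

lemma is_coproductD:
  assumes "is_coproduct C I A X \<nu>"
  shows "X \<in> Obj C" "i \<in> I \<Longrightarrow> A i \<in> Obj C" "i \<in> I \<Longrightarrow> \<nu> i \<in> hom C (A i) X"
  using assms by (auto simp: is_coproduct_def)

lemma is_coproduct_ex1:
  assumes "is_coproduct C I A X \<nu>" and "Y \<in> Obj C" and "\<And>i. i \<in> I \<Longrightarrow> g i \<in> hom C (A i) Y"
  shows "\<exists>!h. h \<in> hom C X Y \<and> (\<forall>i\<in>I. Comp C h (\<nu> i) = g i)"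
  using assms unfolding is_coproduct_def by simp

lemma is_coproduct_arr_eqI:
  assumes "is_coproduct C I A X \<nu>" and "f \<in> hom C X Y" "g \<in> hom C X Y"
    and "\<And>i. i \<in> I \<Longrightarrow> Comp C f (\<nu> i) = Comp C g (\<nu> i)"
  shows "f = g"
proof -
  have "\<exists>!h. h \<in> hom C X Y \<and> (\<forall>i\<in>I. Comp C h (\<nu> i) = Comp C f (\<nu> i))"
    using is_coproduct_ex1[OF assms(1)] hom_Obj[OF assms(2)]
      Comp_in_hom[OF is_coproductD(3)[OF assms(1)] assms(2)] by simp
  moreover have "\<forall>i\<in>I. Comp C g (\<nu> i) = Comp C f (\<nu> i)" using assms(4) by simp
  ultimately show ?thesis using assms(2,3) by blast
qed

lemma is_coproduct_arr_ex:
  assumes "is_coproduct C I A X \<nu>" and "Y \<in> Obj C" and "\<And>i. i \<in> I \<Longrightarrow> g i \<in> hom C (A i) Y"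
  obtains h where "h \<in> hom C X Y" "\<And>i. i \<in> I \<Longrightarrow> Comp C h (\<nu> i) = g i"
  using is_coproduct_ex1[OF assms] that by blast

lemma is_coproductI:
  assumes "X \<in> Obj C" and "\<And>i. i \<in> I \<Longrightarrow> \<nu> i \<in> hom C (A i) X"
    and "\<And>Y g. Y \<in> Obj C \<Longrightarrow> \<forall>i\<in>I. g i \<in> hom C (A i) Y \<Longrightarrow>
      \<exists>h \<in> hom C X Y. \<forall>i\<in>I. Comp C h (\<nu> i) = g i"
    and "\<And>Y f g. f \<in> hom C X Y \<Longrightarrow> g \<in> hom C X Y \<Longrightarrow>
      \<forall>i\<in>I. Comp C f (\<nu> i) = Comp C g (\<nu> i) \<Longrightarrow> f = g"
  shows "is_coproduct C I A X \<nu>"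
  unfolding is_coproduct_def
proof (intro conjI ballI allI impI)
  fix Y g assume Y: "Y \<in> Obj C" and g: "\<forall>i\<in>I. g i \<in> hom C (A i) Y"
  obtain h where "h \<in> hom C X Y" "\<forall>i\<in>I. Comp C h (\<nu> i) = g i" using assms(3)[OF Y g] by blast
  then show "\<exists>!h. h \<in> hom C X Y \<and> (\<forall>i\<in>I. Comp C h (\<nu> i) = g i)"
    using assms(4) by (intro ex1I[of _ h]) (blast, metis)
qed (use assms(1,2) hom_Obj in blast)+

lemma is_coproduct_iso:
  assumes X: "is_coproduct C I A X \<nu>" and f: "f \<in> hom C X Z" and iso: "iso_arr C f"
  shows "is_coproduct C I A Z (\<lambda>i. Comp C f (\<nu> i))"
proof (rule is_coproductI)
  obtain k where k: "k \<in> hom C Z X" "Comp C k f = Id C X" "Comp C f k = Id C Z"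
    using iso iso_arr_hom_iff[OF f] by auto
  show "Z \<in> Obj C" using hom_Obj[OF f] by simp
  show "i \<in> I \<Longrightarrow> Comp C f (\<nu> i) \<in> hom C (A i) Z" for i
    using is_coproductD(3)[OF X] Comp_in_hom f by metis
  fix Y
  { fix g assume Y: "Y \<in> Obj C" and g: "\<forall>i\<in>I. g i \<in> hom C (A i) Y"
    obtain h where h: "h \<in> hom C X Y" "\<And>i. i \<in> I \<Longrightarrow> Comp C h (\<nu> i) = g i"
      using is_coproduct_arr_ex[OF X Y] g by metis
    have hk: "Comp C h k \<in> hom C Z Y" using Comp_in_hom k(1) h(1) by metis
    have "Comp C (Comp C h k) (Comp C f (\<nu> i)) = g i" if i: "i \<in> I" for i
    proof -
      have "Comp C (Comp C h k) (Comp C f (\<nu> i)) = Comp C h (Comp C (Comp C k f) (\<nu> i))"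
        using Comp_assoc[OF Comp_in_hom[OF is_coproductD(3)[OF X i] f] k(1) h(1)]
          Comp_assoc[OF is_coproductD(3)[OF X i] f k(1)] by simp
      then show ?thesis using k(2) Comp_Id_left[OF is_coproductD(3)[OF X i]] h(2)[OF i] by simp
    qed
    then show "\<exists>h \<in> hom C Z Y. \<forall>i\<in>I. Comp C h (Comp C f (\<nu> i)) = g i" using hk by blast }
  fix g h assume g: "g \<in> hom C Z Y" and h: "h \<in> hom C Z Y"
    and eq: "\<forall>i\<in>I. Comp C g (Comp C f (\<nu> i)) = Comp C h (Comp C f (\<nu> i))"
  have "Comp C g f = Comp C h f"
  proof (rule is_coproduct_arr_eqI[OF X])
    show "Comp C g f \<in> hom C X Y" "Comp C h f \<in> hom C X Y" using Comp_in_hom f g h by metis+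
    fix i assume i: "i \<in> I"
    show "Comp C (Comp C g f) (\<nu> i) = Comp C (Comp C h f) (\<nu> i)"
      using eq i Comp_assoc[OF is_coproductD(3)[OF X i] f] g h by metis
  qed
  then have "Comp C g (Comp C f k) = Comp C h (Comp C f k)"
    using Comp_assoc[OF k(1) f] g h by metis
  then show "g = h" using k(3) Comp_Id_right g h by metis
qed

lemma iso_to_coproduct_iff: "iso_to_coproduct C A I F \<longleftrightarrow> (\<exists>\<nu>. is_coproduct C I F A \<nu>)"
proof
  assume "iso_to_coproduct C A I F"
  then obtain X \<nu> where X: "is_coproduct C I F X \<nu>" and "isomorphic C X A"
    using isomorphic_sym unfolding iso_to_coproduct_def by blast
  then show "\<exists>\<nu>. is_coproduct C I F A \<nu>"
    using is_coproduct_iso[OF X] unfolding isomorphic_def by blast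
next
  assume "\<exists>\<nu>. is_coproduct C I F A \<nu>"
  then show "iso_to_coproduct C A I F"
    using isomorphic_refl is_coproductD(1) unfolding iso_to_coproduct_def by blast
qed

lemma initial_arr_eq: "initial C T \<Longrightarrow> f \<in> hom C T A \<Longrightarrow> g \<in> hom C T A \<Longrightarrow> f = g"
  using hom_Obj unfolding initial_def by metis

lemma initial_if_retract:
  assumes T: "initial C T" and f: "f \<in> hom C T S" and g: "g \<in> hom C S T" and fg: "Comp C f g = Id C S"
  shows "initial C S"
  unfolding initial_def
proof (intro conjI ballI)
  show "S \<in> Obj C" using hom_Obj[OF f] by simp
  fix A assume "A \<in> Obj C"
  then obtain k where k: "k \<in> hom C T A" using T unfolding initial_def by blast
  show "\<exists>!h. h \<in> hom C S A"
  proof (rule ex1I[of _ "Comp C k g"])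
    show "Comp C k g \<in> hom C S A" using Comp_in_hom[OF g k] .
    fix h assume h: "h \<in> hom C S A"
    have "Comp C h f = k" using initial_arr_eq[OF T Comp_in_hom[OF f h] k] .
    then show "h = Comp C k g"
      using Comp_assoc[OF g f h] fg Comp_Id_right[OF h] by simp
  qed
qed

lemma initial_if_isomorphic: "initial C T \<Longrightarrow> isomorphic C A T \<Longrightarrow> initial C A"
  by (metis isomorphicE initial_if_retract)

text \<open>Transport along isomorphisms removes them from the definition: only coproduct cocones with
  apex \<open>A\<close> itself have to be tested.\<close>

lemma indecomposable_iff:
  "indecomposable C A \<longleftrightarrow> noninitial C A \<and>
    (\<forall>B0 B1 \<nu>0 \<nu>1. is_coproduct2 C B0 B1 A \<nu>0 \<nu>1 \<longrightarrow> initial C B0 \<or> initial C B1)"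
    (is "?L \<longleftrightarrow> ?R")
proof
  assume L: ?L
  then have A: "A \<in> Obj C" "isomorphic C A A"
    using isomorphic_refl by (auto simp: indecomposable_def)
  have "B0 \<in> Obj C \<and> B1 \<in> Obj C" if "is_coproduct2 C B0 B1 A \<nu>0 \<nu>1" for B0 B1 \<nu>0 \<nu>1
    using that by (auto simp: is_coproduct2_def is_coproduct_def split: bool.splits)
  then show ?R using L A unfolding indecomposable_def noninitial_def by blast
next
  assume R: ?R
  have "initial C B0 \<or> initial C B1"
    if X: "is_coproduct2 C B0 B1 X \<nu>0 \<nu>1" and iso: "isomorphic C A X" for B0 B1 X \<nu>0 \<nu>1
  proof -
    obtain f where "f \<in> hom C X A" "iso_arr C f"
      using isomorphic_sym[OF iso] by (auto simp: isomorphic_def)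
    then have "is_coproduct C UNIV (case_bool B0 B1) A (\<lambda>i. Comp C f (case_bool \<nu>0 \<nu>1 i))"
      using is_coproduct_iso X unfolding is_coproduct2_def by metis
    moreover have "(\<lambda>i. Comp C f (case_bool \<nu>0 \<nu>1 i)) = case_bool (Comp C f \<nu>0) (Comp C f \<nu>1)"
      by (auto split: bool.splits)
    ultimately show ?thesis using R unfolding is_coproduct2_def by metis
  qed
  then show ?L
    using R initial_if_isomorphic unfolding indecomposable_def noninitial_def by blast
qed

lemma is_coproduct_empty_initial:
  assumes "is_coproduct C {} F A \<nu>" shows "initial C A"
  using assms unfolding initial_def is_coproduct_def by auto

text \<open>Associativity of coproducts, in the form that separates one summand from the others. It makes
  statements about binary coproducts available for arbitrary ones.\<close>

lemma is_coproduct2_split: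
  assumes X: "is_coproduct C I A X \<nu>" and j: "j \<in> I" and Q: "is_coproduct C (I - {j}) A Q \<mu>"
    and q: "q \<in> hom C Q X" and q\<mu>: "\<And>i. i \<in> I - {j} \<Longrightarrow> Comp C q (\<mu> i) = \<nu> i"
  shows "is_coproduct2 C (A j) Q X (\<nu> j) q"
  unfolding is_coproduct2_def
proof (rule is_coproductI)
  show "X \<in> Obj C" using is_coproductD(1)[OF X] .
  show "case_bool (\<nu> j) q i \<in> hom C (case_bool (A j) Q i) X" for i
    using q is_coproductD(3)[OF X j] by (cases i) auto
  fix Y
  { fix g assume Y: "Y \<in> Obj C" and g: "\<forall>i\<in>UNIV. g i \<in> hom C (case_bool (A j) Q i) Y"
    have gT: "g True \<in> hom C (A j) Y" and gF: "g False \<in> hom C Q Y"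
      using g by (auto dest: spec[of _ True] spec[of _ False])
    define k where "k = (\<lambda>i. if i = j then g True else Comp C (g False) (\<mu> i))"
    have "k i \<in> hom C (A i) Y" if "i \<in> I" for i
      using gT Comp_in_hom[OF is_coproductD(3)[OF Q] gF] that by (auto simp: k_def)
    then obtain h where h: "h \<in> hom C X Y" "\<And>i. i \<in> I \<Longrightarrow> Comp C h (\<nu> i) = k i"
      using is_coproduct_arr_ex[OF X Y] by blast
    have "Comp C h q = g False"
    proof (rule is_coproduct_arr_eqI[OF Q Comp_in_hom[OF q h(1)] gF])
      fix i assume i: "i \<in> I - {j}"
      then show "Comp C (Comp C h q) (\<mu> i) = Comp C (g False) (\<mu> i)"
        using Comp_assoc[OF is_coproductD(3)[OF Q i] q h(1)] q\<mu>[OF i] h(2)[of i] by (auto simp: k_def)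
    qed
    then have "\<forall>i. Comp C h (case_bool (\<nu> j) q i) = g i"
      using h(2)[OF j] by (auto simp: k_def split: bool.splits)
    then show "\<exists>h \<in> hom C X Y. \<forall>i\<in>UNIV. Comp C h (case_bool (\<nu> j) q i) = g i"
      using h(1) by blast }
  fix g h assume g: "g \<in> hom C X Y" and h: "h \<in> hom C X Y"
    and eq: "\<forall>i\<in>UNIV. Comp C g (case_bool (\<nu> j) q i) = Comp C h (case_bool (\<nu> j) q i)"
  have eqs: "Comp C g (\<nu> j) = Comp C h (\<nu> j)" "Comp C g q = Comp C h q"
    using eq by (auto dest: spec[of _ True] spec[of _ False])
  show "g = h"
  proof (rule is_coproduct_arr_eqI[OF X g h])
    fix i assume i: "i \<in> I"
    show "Comp C g (\<nu> i) = Comp C h (\<nu> i)"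
    proof (cases "i = j")
      case False
      then have i': "i \<in> I - {j}" using i by simp
      show ?thesis
        using Comp_assoc[OF is_coproductD(3)[OF Q i'] q] g h eqs(2) q\<mu>[OF i'] by metis
    qed (use eqs in simp)
  qed
qed

end


section \<open>Arrows as functions\<close>

context UD_category
begin

abbreviation pts :: "'o \<Rightarrow> 'u set" where "pts \<equiv> on_obj U"

abbreviation act :: "'m \<Rightarrow> 'u \<Rightarrow> 'u" where "act f \<equiv> sfun (on_arr U f)"

lemma act_in: "f \<in> hom C A B \<Longrightarrow> x \<in> pts A \<Longrightarrow> act f x \<in> pts B"
  using on_arr_in_hom[of f A B] by (auto simp: hom_def Set_cat_def)

lemma act_Comp:
  "f \<in> hom C A B \<Longrightarrow> g \<in> hom C B D \<Longrightarrow> x \<in> pts A \<Longrightarrow> act (Comp C g f) x = act g (act f x)"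
  using on_arr_in_hom[of f A B] on_arr_Comp[of f A B g D]
  by (auto simp: hom_def Set_cat_def compose_def)

lemma act_Id: "A \<in> Obj C \<Longrightarrow> x \<in> pts A \<Longrightarrow> act (Id C A) x = x"
  using on_arr_Id[of A] by (simp add: Set_cat_def)

lemma arr_eqI:
  assumes f: "f \<in> hom C A B" and g: "g \<in> hom C A B" and eq: "\<And>x. x \<in> pts A \<Longrightarrow> act f x = act g x"
  shows "f = g"
proof (rule faithful[OF f g])
  have "act f \<in> extensional (pts A)" "act g \<in> extensional (pts A)"
    using on_arr_in_hom[OF f] on_arr_in_hom[OF g] by (auto simp: hom_def Set_cat_def PiE_def)
  then have "act f = act g" using eq by (rule extensionalityI)
  then show "on_arr U f = on_arr U g"
    using on_arr_in_hom[OF f] on_arr_in_hom[OF g]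
    by (auto simp: hom_def Set_cat_def intro: set_arrow.expand)
qed

lemma uimage_subset: "f \<in> hom C A B \<Longrightarrow> uimage U A f \<subseteq> pts B"
  using act_in by (auto simp: uimage_def)

lemma uimage_Comp:
  "f \<in> hom C A B \<Longrightarrow> g \<in> hom C B D \<Longrightarrow> uimage U A (Comp C g f) = act g ` uimage U A f"
  using act_Comp by (auto simp: uimage_def image_iff)

lemma mono_if_inj_on:
  assumes m: "m \<in> hom C A B" and inj: "inj_on (act m) (pts A)"
  shows "mono_arr C m"
proof -
  have "f = g" if f: "f \<in> hom C D A" and g: "g \<in> hom C D A" and eq: "Comp C m f = Comp C m g" for D f g
  proof (rule arr_eqI[OF f g])
    fix x assume x: "x \<in> pts D"
    have "act m (act f x) = act m (act g x)"
      using act_Comp[OF f m x] act_Comp[OF g m x] eq by simp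
    then show "act f x = act g x" using inj act_in[OF f x] act_in[OF g x] by (simp add: inj_on_def)
  qed
  then show ?thesis using source.hom_Arr[OF m] unfolding mono_arr_def by metis
qed

lemma epi_if_surj:
  assumes e: "e \<in> hom C A B" and surj: "uimage U A e = pts B"
  shows "epi_arr C e"
proof -
  have "f = g" if f: "f \<in> hom C B D" and g: "g \<in> hom C B D" and eq: "Comp C f e = Comp C g e" for D f g
  proof (rule arr_eqI[OF f g])
    fix y assume "y \<in> pts B"
    then obtain x where x: "x \<in> pts A" "y = act e x" using surj by (auto simp: uimage_def)
    then show "act f y = act g y" using act_Comp[OF e f x(1)] act_Comp[OF e g x(1)] eq by simp
  qed
  then show ?thesis using source.hom_Arr[OF e] unfolding epi_arr_def by metis
qed

lemma iso_if_bij: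
  "f \<in> hom C A B \<Longrightarrow> inj_on (act f) (pts A) \<Longrightarrow> uimage U A f = pts B \<Longrightarrow> iso_arr C f"
  using mono_if_inj_on epi_if_surj UD1_balanced unfolding balanced_def by blast

lemma inj_on_if_comp:
  assumes "f \<in> hom C A B" "g \<in> hom C B D" and "inj_on (act (Comp C g f)) (pts A)"
  shows "inj_on (act f) (pts A)"
  using assms(3) act_Comp[OF assms(1,2)] unfolding inj_on_def by metis

lemma act_incl:
  "incl_subobject C U A S \<iota> \<Longrightarrow> x \<in> pts S \<Longrightarrow> act \<iota> x = x"
  by (auto simp: incl_subobject_def set_incl_def)

lemma uimage_incl: "incl_subobject C U A S \<iota> \<Longrightarrow> uimage U S \<iota> = pts S"
  using act_incl by (auto simp: uimage_def image_iff)

text \<open>Restricted to its image, a monomorphism stays mono and becomes surjective on points, hence epi.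
  Balancedness makes the restriction invertible, and invertible arrows are injective on points.\<close>

lemma inj_on_if_mono:
  assumes m: "m \<in> hom C A B" and mono: "mono_arr C m"
  shows "inj_on (act m) (pts A)"
proof -
  obtain S \<iota> where S: "incl_subobject C U B S \<iota>" "pts S = uimage U A m" using UD2[OF m] by blast
  have \<iota>: "subobject C B S \<iota>" "\<iota> \<in> hom C S B" using S by (auto simp: incl_subobject_def subobject_def)
  obtain g where g: "g \<in> hom C A S" "m = Comp C \<iota> g"
    using UD3[OF m \<iota>(1)] uimage_incl[OF S(1)] S(2) by auto
  have ag: "act g x = act m x" if "x \<in> pts A" for x
    using act_Comp[OF g(1) \<iota>(2) that] act_incl[OF S(1) act_in[OF g(1) that]] g(2) by simp
  have "epi_arr C g"
    using epi_if_surj[OF g(1)] ag S(2) by (simp add: uimage_def)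
  moreover have "mono_arr C g"
    unfolding mono_arr_def
  proof (intro conjI allI ballI impI)
    show "g \<in> Arr C" using source.hom_Arr[OF g(1)] by simp
    fix D f h assume f: "f \<in> hom C D (Dom C g)" and h: "h \<in> hom C D (Dom C g)"
      and eq: "Comp C g f = Comp C g h"
    have fh: "f \<in> hom C D A" "h \<in> hom C D A" using f h source.hom_Arr[OF g(1)] by auto
    have "Comp C m f = Comp C m h"
      using eq source.Comp_assoc[OF fh(1) g(1) \<iota>(2)] source.Comp_assoc[OF fh(2) g(1) \<iota>(2)] g(2) by simp
    then show "f = h" using mono fh source.hom_Arr[OF m] unfolding mono_arr_def by blast
  qed
  ultimately have "iso_arr C g" using UD1_balanced unfolding balanced_def by blast
  then obtain k where k: "k \<in> hom C S A" "Comp C k g = Id C A"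
    using source.iso_arr_hom_iff[OF g(1)] by blast
  have A: "A \<in> Obj C" using source.hom_Obj[OF m] by simp
  have "act k (act m x) = x" if "x \<in> pts A" for x
    using act_Comp[OF g(1) k(1) that] k(2) act_Id[OF A that] ag[OF that] by simp
  then show ?thesis by (metis inj_onI)
qed

lemma subobjectD:
  assumes "subobject C A S \<nu>"
  shows "\<nu> \<in> hom C S A" "inj_on (act \<nu>) (pts S)" "A \<in> Obj C" "S \<in> Obj C"
  using assms inj_on_if_mono source.hom_Obj[of \<nu> S A] by (auto simp: subobject_def)

lemma subobjectI: "\<nu> \<in> hom C S A \<Longrightarrow> inj_on (act \<nu>) (pts S) \<Longrightarrow> subobject C A S \<nu>"
  using source.hom_Obj[of \<nu> S A] mono_if_inj_on by (auto simp: subobject_def)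

lemma incl_subobjectD: "incl_subobject C U A S \<iota> \<Longrightarrow> subobject C A S \<iota>"
  by (simp add: incl_subobject_def)

lemma subobject_factor:
  assumes S: "subobject C A S \<nu>" and T: "subobject C A T \<mu>" and sub: "uimage U S \<nu> \<subseteq> uimage U T \<mu>"
  obtains g where "subobject C T S g" "\<nu> = Comp C \<mu> g"
proof -
  obtain g where g: "g \<in> hom C S T" "\<nu> = Comp C \<mu> g"
    using UD3[OF subobjectD(1)[OF S] T sub] by blast
  have "inj_on (act g) (pts S)"
    using inj_on_if_comp[OF g(1) subobjectD(1)[OF T]] subobjectD(2)[OF S] g(2) by simp
  then show ?thesis using that subobjectI g by blast
qed

text \<open>A subobject is its image: the arrow between two subobjects with the same image is bijective on
  points.\<close>

lemma isomorphic_if_same_image: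
  assumes S: "subobject C A S \<nu>" and T: "subobject C A T \<mu>" and eq: "uimage U S \<nu> = uimage U T \<mu>"
  shows "isomorphic C S T"
proof -
  obtain g where g: "subobject C T S g" "\<nu> = Comp C \<mu> g" using subobject_factor[OF S T] eq by blast
  note gh = subobjectD(1)[OF g(1)] and Th = subobjectD(1)[OF T]
  have "act \<mu> ` uimage U S g = act \<mu> ` pts T"
    using uimage_Comp[OF gh Th] g(2) eq by (simp add: uimage_def)
  then have "uimage U S g = pts T"
    using subobjectD(2)[OF T] uimage_subset[OF gh] by (metis inj_on_image_eq_iff subset_refl)
  then show ?thesis
    using iso_if_bij[OF gh subobjectD(2)[OF g(1)]] gh unfolding isomorphic_def by blast
qed


section \<open>The image of the initial object\<close>

text \<open>The underlying set of the initial object can be nonempty, so subobjects of \<open>A\<close> are as disjoint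
  as possible when they meet only in its image. The union over all initial objects avoids the choice
  of one of them; they all have the same image (\<open>trivial_pts_eq\<close>).\<close>

definition trivial_pts :: "'o \<Rightarrow> 'u set" where
  "trivial_pts A = \<Union> {uimage U T f |T f. initial C T \<and> f \<in> hom C T A}"

lemma initial_ex: "\<exists>\<theta>. initial C \<theta>"
  using UD1_initial by blast

text \<open>\<open>UD1\<close> speaks of the arrows out of one particular initial object \<open>\<theta>\<close>; any other one is
  reached through the isomorphism with \<open>\<theta>\<close>.\<close>

lemma initial_subobject:
  assumes T: "initial C T" and f: "f \<in> hom C T A" shows "subobject C A T f"
proof -
  obtain \<theta> where \<theta>: "initial C \<theta>" "\<forall>B \<in> Obj C. \<forall>f \<in> hom C \<theta> B. mono_arr C f"
    using UD1_initial by blast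
  have TO: "T \<in> Obj C" "\<theta> \<in> Obj C" using T \<theta>(1) by (auto simp: initial_def)
  obtain g k where g: "g \<in> hom C T \<theta>" "k \<in> hom C \<theta> T"
    using T \<theta>(1) TO unfolding initial_def by blast
  note fk = source.Comp_in_hom[OF g(2) f]
  have inj: "inj_on (act (Comp C f k)) (pts \<theta>)"
    using inj_on_if_mono[OF fk] \<theta>(2) fk source.hom_Obj[OF f] by blast
  have kg: "Comp C k g = Id C T"
    using source.initial_arr_eq[OF T source.Comp_in_hom[OF g] source.Id_in_hom[OF TO(1)]] .
  have "inj_on (act (Comp C k g)) (pts T)"
    using kg act_Id[OF TO(1)] by (simp add: inj_on_def)
  then have injg: "inj_on (act g) (pts T)" using inj_on_if_comp[OF g(1,2)] by blast
  have "f = Comp C (Comp C f k) g"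
    using source.Comp_assoc[OF g f] kg source.Comp_Id_right[OF f] by simp
  then have "act f x = act (Comp C f k) (act g x)" if "x \<in> pts T" for x
    using act_Comp[OF g(1) fk that] by simp
  then have "inj_on (act f) (pts T)"
    using inj injg act_in[OF g(1)] unfolding inj_on_def by metis
  then show ?thesis using subobjectI[OF f] by simp
qed

lemma trivial_pts_eq:
  assumes T: "initial C T" and f: "f \<in> hom C T A" shows "trivial_pts A = uimage U T f"
proof -
  have "uimage U S g \<subseteq> uimage U T f" if S: "initial C S" and g: "g \<in> hom C S A" for S g
  proof -
    obtain k where k: "k \<in> hom C S T" using S T unfolding initial_def by blast
    have "g = Comp C f k" using source.initial_arr_eq[OF S g source.Comp_in_hom[OF k f]] .
    then show ?thesis
      using uimage_Comp[OF k f] uimage_subset[OF k] by (auto simp: uimage_def)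
  qed
  then show ?thesis using T f unfolding trivial_pts_def by blast
qed

lemma trivial_pts_witness:
  assumes "A \<in> Obj C"
  obtains T k where "initial C T" "k \<in> hom C T A" "trivial_pts A = uimage U T k"
  using assms initial_ex trivial_pts_eq unfolding initial_def by metis

lemma trivial_pts_map:
  assumes f: "f \<in> hom C A B" shows "trivial_pts B = act f ` trivial_pts A"
proof -
  obtain T k where T: "initial C T" and k: "k \<in> hom C T A" and triv: "trivial_pts A = uimage U T k"
    using trivial_pts_witness source.hom_Obj[OF f] by blast
  show ?thesis
    using triv trivial_pts_eq[OF T source.Comp_in_hom[OF k f]] uimage_Comp[OF k f]
    by simp
qed

lemma trivial_pts_subset: "trivial_pts A \<subseteq> pts A"
  using uimage_subset unfolding trivial_pts_def by blast

lemma trivial_pts_subset_uimage: "f \<in> hom C A B \<Longrightarrow> trivial_pts B \<subseteq> uimage U A f"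
  using trivial_pts_map trivial_pts_subset unfolding uimage_def by blast

text \<open>Triviality of a point does not depend on the ambient object, since the arrow from the initial
  object to \<open>A\<close> passes through every subobject.\<close>

lemma act_trivial_iff:
  assumes S: "subobject C A S \<nu>" and x: "x \<in> pts S"
  shows "act \<nu> x \<in> trivial_pts A \<longleftrightarrow> x \<in> trivial_pts S"
  using trivial_pts_map[OF subobjectD(1)[OF S]]
    inj_on_image_mem_iff[OF subobjectD(2)[OF S] x trivial_pts_subset] by simp

lemma initial_iff_image_trivial:
  assumes S: "subobject C A S \<nu>"
  shows "initial C S \<longleftrightarrow> uimage U S \<nu> \<subseteq> trivial_pts A"
proof
  assume "initial C S"
  then show "uimage U S \<nu> \<subseteq> trivial_pts A" using trivial_pts_eq subobjectD(1)[OF S] by blast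
next
  assume sub: "uimage U S \<nu> \<subseteq> trivial_pts A"
  obtain T k where T: "initial C T" and k: "k \<in> hom C T A" and triv: "trivial_pts A = uimage U T k"
    using trivial_pts_witness subobjectD(3)[OF S] by blast
  have "uimage U S \<nu> = uimage U T k"
    using sub triv trivial_pts_subset_uimage[OF subobjectD(1)[OF S]] by blast
  then have "isomorphic C S T" using isomorphic_if_same_image[OF S initial_subobject[OF T k]] by blast
  then show "initial C S" using source.initial_if_isomorphic[OF T] by blast
qed

lemma initial_iff_trivial:
  assumes A: "A \<in> Obj C" shows "initial C A \<longleftrightarrow> pts A \<subseteq> trivial_pts A"
proof -
  have "uimage U A (Id C A) = pts A" using act_Id[OF A] by (auto simp: uimage_def image_iff)
  moreover have "subobject C A A (Id C A)"
    using subobjectI[OF source.Id_in_hom[OF A]] act_Id[OF A] by (simp add: inj_on_def)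
  ultimately show ?thesis using initial_iff_image_trivial by metis
qed


lemma inj_on_trivial_pts:
  assumes f: "f \<in> hom C A B" shows "inj_on (act f) (trivial_pts A)"
proof -
  obtain T k where T: "initial C T" and k: "k \<in> hom C T A" and triv: "trivial_pts A = uimage U T k"
    using trivial_pts_witness source.hom_Obj[OF f] by blast
  have "inj_on (act (Comp C f k)) (pts T)"
    using subobjectD(2)[OF initial_subobject[OF T source.Comp_in_hom[OF k f]]] .
  then have "inj_on (act f) (act k ` pts T)"
    using act_Comp[OF k f] by (auto simp: inj_on_def)
  then show ?thesis using triv by (simp add: uimage_def)
qed


section \<open>Coproducts as covers by almost disjoint subobjects\<close>

lemma small_coproduct_ex:
  assumes I: "small \<S> I" and F: "\<And>i. i \<in> I \<Longrightarrow> F i \<in> Obj C"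
  shows "\<exists>X \<nu>. is_coproduct C I F X \<nu>"
proof -
  obtain J e where J: "J \<in> \<S>" and e: "bij_betw e J I" using I unfolding small_def by blast
  have FJ: "\<forall>j\<in>J. F (e j) \<in> Obj C" using F e by (auto simp: bij_betw_def)
  then obtain X \<nu> where X: "is_coproduct C J (\<lambda>j. F (e j)) X \<nu>"
    using UD1_coproducts J unfolding coproduct_complete_def by meson
  let ?d = "inv_into J e"
  have ed: "e (?d i) = i" if "i \<in> I" for i using e that by (simp add: bij_betw_inv_into_right)
  have "is_coproduct C I (\<lambda>i. F (e (?d i))) X (\<lambda>i. \<nu> (?d i))"
    using is_coproduct_reindex[OF X bij_betw_inv_into[OF e]] .
  then have "is_coproduct C I F X (\<lambda>i. \<nu> (?d i))" using ed by (simp add: is_coproduct_def)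
  then show ?thesis by blast
qed

lemma small_lattice_ex:
  assumes A: "A \<in> Obj C" and I: "small \<S> I" "I \<noteq> {}"
    and F: "\<And>i. i \<in> I \<Longrightarrow> subobject C A (F i) (\<mu> i)"
  shows "\<exists>T \<iota>. is_intersection C U A I F \<mu> T \<iota>" and "\<exists>T \<iota>. is_union C U A I F \<mu> T \<iota>"
proof -
  obtain J e where J: "J \<in> \<S>" and e: "bij_betw e J I" using I unfolding small_def by blast
  have I_eq: "I = e ` J" using e by (simp add: bij_betw_def)
  have "subobject C A (F (e j)) (\<mu> (e j))" if "j \<in> J" for j using F that I_eq by blast
  moreover have "J \<noteq> {}" using I(2) I_eq by blast
  ultimately have "(\<exists>T \<iota>. is_intersection C U A J (\<lambda>j. F (e j)) (\<lambda>j. \<mu> (e j)) T \<iota>) \<and>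
      (\<exists>T \<iota>. is_union C U A J (\<lambda>j. F (e j)) (\<lambda>j. \<mu> (e j)) T \<iota>)"
    using UD4[OF A J, of "\<lambda>j. F (e j)" "\<lambda>j. \<mu> (e j)"] by blast
  then show "\<exists>T \<iota>. is_intersection C U A I F \<mu> T \<iota>" "\<exists>T \<iota>. is_union C U A I F \<mu> T \<iota>"
    by (simp_all add: is_intersection_def is_union_def I_eq)
qed

text \<open>The images of the injections have a union \<open>T\<close> in \<open>X\<close>, through which all injections factor. The
  arrow from \<open>X\<close> to \<open>T\<close> that they induce is a section of the inclusion of \<open>T\<close>, so \<open>T\<close> contains
  every point.\<close>

lemma coproduct_cover:
  assumes X: "is_coproduct C I F X \<nu>" and I: "small \<S> I" "I \<noteq> {}"
  shows "pts X = (\<Union>i\<in>I. uimage U (F i) (\<nu> i))"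
proof
  note \<nu> = source.is_coproductD(3)[OF X]
  have "\<forall>i\<in>I. \<exists>S \<iota>. incl_subobject C U X S \<iota> \<and> pts S = uimage U (F i) (\<nu> i)"
    using UD2[OF \<nu>] by blast
  then obtain S \<iota> where S: "\<And>i. i \<in> I \<Longrightarrow> incl_subobject C U X (S i) (\<iota> i)"
    "\<And>i. i \<in> I \<Longrightarrow> pts (S i) = uimage U (F i) (\<nu> i)"
    by metis
  obtain T \<tau> where "is_union C U X I S \<iota> T \<tau>"
    using small_lattice_ex(2)[OF source.is_coproductD(1)[OF X] I, of S \<iota>] incl_subobjectD[OF S(1)] by blast
  then have T: "incl_subobject C U X T \<tau>" "pts T = (\<Union>i\<in>I. uimage U (F i) (\<nu> i))"
    using S uimage_incl[OF S(1)] by (auto simp: is_union_def)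
  note T' = incl_subobjectD[OF T(1)] and \<tau> = subobjectD(1)[OF incl_subobjectD[OF T(1)]]
  have "\<forall>i\<in>I. \<exists>g \<in> hom C (F i) T. \<nu> i = Comp C \<tau> g"
  proof
    fix i assume i: "i \<in> I"
    then have "uimage U (F i) (\<nu> i) \<subseteq> uimage U T \<tau>" using uimage_incl[OF T(1)] T(2) by blast
    then show "\<exists>g \<in> hom C (F i) T. \<nu> i = Comp C \<tau> g" using UD3[OF \<nu>[OF i] T'] by blast
  qed
  then obtain g where g: "\<And>i. i \<in> I \<Longrightarrow> g i \<in> hom C (F i) T" "\<And>i. i \<in> I \<Longrightarrow> \<nu> i = Comp C \<tau> (g i)"
    by metis
  obtain h where h: "h \<in> hom C X T" "\<And>i. i \<in> I \<Longrightarrow> Comp C h (\<nu> i) = g i"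
    using source.is_coproduct_arr_ex[OF X subobjectD(4)[OF T'], of g] g(1) by blast
  have "Comp C \<tau> h = Id C X"
  proof (rule source.is_coproduct_arr_eqI[OF X source.Comp_in_hom[OF h(1) \<tau>]
        source.Id_in_hom[OF source.is_coproductD(1)[OF X]]])
    fix i assume i: "i \<in> I"
    show "Comp C (Comp C \<tau> h) (\<nu> i) = Comp C (Id C X) (\<nu> i)"
      using source.Comp_assoc[OF \<nu>[OF i] h(1) \<tau>] h(2)[OF i] g(2)[OF i] source.Comp_Id_left[OF \<nu>[OF i]]
      by simp
  qed
  then have "x \<in> pts T" if "x \<in> pts X" for x
    using act_Comp[OF h(1) \<tau> that] act_Id[OF source.is_coproductD(1)[OF X] that]
      act_in[OF h(1) that] act_incl[OF T(1)] by simp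
  then show "pts X \<subseteq> (\<Union>i\<in>I. uimage U (F i) (\<nu> i))" using T(2) by blast
  show "(\<Union>i\<in>I. uimage U (F i) (\<nu> i)) \<subseteq> pts X" using uimage_subset[OF \<nu>] by blast
qed

lemma coproduct2_decomposes:
  assumes X: "is_coproduct2 C A0 A1 X \<nu>0 \<nu>1"
  shows "subobject C X A0 \<nu>0" "subobject C X A1 \<nu>1"
    and "uimage U A0 \<nu>0 \<union> uimage U A1 \<nu>1 = pts X"
    and "uimage U A0 \<nu>0 \<inter> uimage U A1 \<nu>1 \<subseteq> trivial_pts X"
proof -
  have X': "is_coproduct C UNIV (case_bool A0 A1) X (case_bool \<nu>0 \<nu>1)"
    using X by (simp add: is_coproduct2_def)
  note bool = small_bool[OF universe]
  show sub: "subobject C X A0 \<nu>0" "subobject C X A1 \<nu>1"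
    using UD5[OF X] source.is_coproductD(2,3)[OF X', of True] source.is_coproductD(2,3)[OF X', of False]
    by (auto simp: subobject_def)
  show "uimage U A0 \<nu>0 \<union> uimage U A1 \<nu>1 = pts X"
    using coproduct_cover[OF X' bool] by (simp add: UNIV_bool Un_commute)
  have "subobject C X (case_bool A0 A1 i) (case_bool \<nu>0 \<nu>1 i)" for i
    using sub by (cases i) auto
  then obtain T \<iota> where T: "is_intersection C U X UNIV (case_bool A0 A1) (case_bool \<nu>0 \<nu>1) T \<iota>"
    using small_lattice_ex(1)[OF source.is_coproductD(1)[OF X'] bool,
        of "case_bool A0 A1" "case_bool \<nu>0 \<nu>1"] by blast
  then have "initial C T" using UD5[OF X] source.initial_if_isomorphic by blast
  moreover have \<iota>: "incl_subobject C U X T \<iota>"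
    and "pts T = uimage U A0 \<nu>0 \<inter> uimage U A1 \<nu>1"
    using T by (auto simp: is_intersection_def UNIV_bool)
  ultimately show "uimage U A0 \<nu>0 \<inter> uimage U A1 \<nu>1 \<subseteq> trivial_pts X"
    using initial_iff_image_trivial[OF incl_subobjectD[OF \<iota>]] uimage_incl[OF \<iota>] by simp
qed

text \<open>The comparison arrow from an abstract coproduct of the \<open>F i\<close> to \<open>A\<close> is surjective by the covering
  condition. It identifies points of different summands only if they are trivial, and on trivial
  points every arrow is injective. So it is bijective, hence an isomorphism.\<close>

lemma coproduct_if_cover:
  assumes I: "small \<S> I" "I \<noteq> {}"
    and F: "\<And>i. i \<in> I \<Longrightarrow> subobject C A (F i) (\<nu> i)"
    and cover: "pts A \<subseteq> (\<Union>i\<in>I. uimage U (F i) (\<nu> i))"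
    and disj: "\<And>i j. i \<in> I \<Longrightarrow> j \<in> I \<Longrightarrow> i \<noteq> j \<Longrightarrow>
      uimage U (F i) (\<nu> i) \<inter> uimage U (F j) (\<nu> j) \<subseteq> trivial_pts A"
  shows "is_coproduct C I F A \<nu>"
proof -
  have A: "A \<in> Obj C" using I(2) subobjectD(3)[OF F] by blast
  note \<nu> = subobjectD(1)[OF F]
  obtain P \<mu> where P: "is_coproduct C I F P \<mu>"
    using small_coproduct_ex[OF I(1)] subobjectD(4)[OF F] by blast
  note \<mu> = source.is_coproductD(3)[OF P]
  obtain h where h: "h \<in> hom C P A" "\<And>i. i \<in> I \<Longrightarrow> Comp C h (\<mu> i) = \<nu> i"
    using source.is_coproduct_arr_ex[OF P A, of \<nu>] \<nu> by blast
  have h\<mu>: "act h (act (\<mu> i) s) = act (\<nu> i) s" if "i \<in> I" "s \<in> pts (F i)" for i s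
    using act_Comp[OF \<mu>[OF that(1)] h(1) that(2)] h(2)[OF that(1)] by simp
  have "inj_on (act h) (pts P)"
  proof (rule inj_onI)
    fix p q assume p: "p \<in> pts P" and q: "q \<in> pts P" and eq: "act h p = act h q"
    obtain i s where i: "i \<in> I" and s: "s \<in> pts (F i)" "p = act (\<mu> i) s"
      using coproduct_cover[OF P I] p by (auto simp: uimage_def)
    obtain j t where j: "j \<in> I" and t: "t \<in> pts (F j)" "q = act (\<mu> j) t"
      using coproduct_cover[OF P I] q by (auto simp: uimage_def)
    have st: "act (\<nu> i) s = act (\<nu> j) t" using eq h\<mu> i j s t by simp
    show "p = q"
    proof (cases "i = j")
      case True
      then show ?thesis using st s t subobjectD(2)[OF F[OF i]] by (auto dest: inj_onD)
    next
      case False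
      then have "act (\<nu> i) s \<in> trivial_pts A" "act (\<nu> j) t \<in> trivial_pts A"
        using disj[OF i j] st s t unfolding uimage_def by auto
      then have "s \<in> trivial_pts (F i)" "t \<in> trivial_pts (F j)"
        using act_trivial_iff[OF F] i j s t by blast+
      then have "p \<in> trivial_pts P" "q \<in> trivial_pts P"
        using trivial_pts_map[OF \<mu>] i j s t by blast+
      then show ?thesis using inj_on_trivial_pts[OF h(1)] eq by (auto dest: inj_onD)
    qed
  qed
  moreover have "uimage U P h = pts A"
  proof
    show "uimage U P h \<subseteq> pts A" using uimage_subset[OF h(1)] .
    show "pts A \<subseteq> uimage U P h"
    proof
      fix x assume "x \<in> pts A"
      then obtain i s where i: "i \<in> I" and s: "s \<in> pts (F i)" "x = act (\<nu> i) s"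
        using cover by (auto simp: uimage_def)
      then show "x \<in> uimage U P h"
        using h\<mu>[OF i s(1)] act_in[OF \<mu>[OF i] s(1)] unfolding uimage_def by (metis imageI)
    qed
  qed
  ultimately have "is_coproduct C I F A (\<lambda>i. Comp C h (\<mu> i))"
    using source.is_coproduct_iso[OF P h(1)] iso_if_bij[OF h(1)] by blast
  then show ?thesis using h(2) by (simp add: is_coproduct_def)
qed


section \<open>Indecomposable subobjects\<close>

text \<open>The intersections of \<open>S\<close> with the two summands cover \<open>S\<close> and meet in trivial points, so \<open>S\<close> is
  their coproduct. Indecomposability makes one of them initial, and \<open>S\<close> lies in the other.\<close>

lemma indecomposable_in_coproduct2:
  assumes X: "is_coproduct2 C B0 B1 X \<beta>0 \<beta>1"
    and S: "subobject C X S \<sigma>" and ind: "indecomposable C S"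
  shows "uimage U S \<sigma> \<subseteq> uimage U B0 \<beta>0 \<or> uimage U S \<sigma> \<subseteq> uimage U B1 \<beta>1"
proof -
  note D = coproduct2_decomposes[OF X] and bool = small_bool[OF universe]
  note \<sigma> = subobjectD(1)[OF S]
  define B where "B = case_bool B0 B1"
  define \<beta> where "\<beta> = case_bool \<beta>0 \<beta>1"
  have B: "subobject C X (B i) (\<beta> i)" for i using D(1,2) by (cases i) (auto simp: B_def \<beta>_def)
  have "\<exists>W g. subobject C S W g \<and> act \<sigma> ` uimage U W g = uimage U S \<sigma> \<inter> uimage U (B i) (\<beta> i)" for i
  proof -
    have "\<And>k. subobject C X (case_bool S (B i) k) (case_bool \<sigma> (\<beta> i) k)"
      using S B by (auto split: bool.splits)
    then obtain W \<omega> where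
      W: "is_intersection C U X UNIV (case_bool S (B i)) (case_bool \<sigma> (\<beta> i)) W \<omega>"
      using small_lattice_ex(1)[OF subobjectD(3)[OF S] bool,
          of "case_bool S (B i)" "case_bool \<sigma> (\<beta> i)"] by blast
    then have \<omega>: "incl_subobject C U X W \<omega>" and W_eq: "pts W = uimage U S \<sigma> \<inter> uimage U (B i) (\<beta> i)"
      by (auto simp: is_intersection_def UNIV_bool)
    obtain g where g: "subobject C S W g" "\<omega> = Comp C \<sigma> g"
      using subobject_factor[OF incl_subobjectD[OF \<omega>] S] uimage_incl[OF \<omega>] W_eq by blast
    have "act \<sigma> ` uimage U W g = pts W"
      using uimage_Comp[OF subobjectD(1)[OF g(1)] \<sigma>] g(2) uimage_incl[OF \<omega>] by simp
    then show ?thesis using g(1) W_eq by blast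
  qed
  then obtain W g where W: "\<And>i. subobject C S (W i) (g i)"
    and im: "\<And>i. act \<sigma> ` uimage U (W i) (g i) = uimage U S \<sigma> \<inter> uimage U (B i) (\<beta> i)"
    by metis
  have mem: "s \<in> uimage U (W i) (g i) \<longleftrightarrow> act \<sigma> s \<in> uimage U (B i) (\<beta> i)" if "s \<in> pts S" for s i
  proof -
    have "s \<in> uimage U (W i) (g i) \<longleftrightarrow> act \<sigma> s \<in> act \<sigma> ` uimage U (W i) (g i)"
      using inj_on_image_mem_iff[OF subobjectD(2)[OF S] that uimage_subset[OF subobjectD(1)[OF W]]] by simp
    also have "\<dots> \<longleftrightarrow> act \<sigma> s \<in> uimage U (B i) (\<beta> i)" using im that by (simp add: uimage_def)
    finally show ?thesis .
  qed
  have "is_coproduct C UNIV W S g"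
  proof (rule coproduct_if_cover[OF bool _ W])
    show "pts S \<subseteq> (\<Union>i\<in>UNIV. uimage U (W i) (g i))"
      using mem D(3) act_in[OF \<sigma>] by (auto simp: UNIV_bool B_def \<beta>_def)
    fix i j :: bool assume "i \<noteq> j"
    then have "uimage U (B i) (\<beta> i) \<inter> uimage U (B j) (\<beta> j) \<subseteq> trivial_pts X"
      using D(4) by (cases i; cases j) (auto simp: B_def \<beta>_def)
    then show "uimage U (W i) (g i) \<inter> uimage U (W j) (g j) \<subseteq> trivial_pts S"
      using mem act_trivial_iff[OF S] uimage_subset[OF subobjectD(1)[OF W]] by blast
  qed simp
  moreover have "W = case_bool (W True) (W False)" "g = case_bool (g True) (g False)"
    by (auto split: bool.splits)
  ultimately have "is_coproduct2 C (W True) (W False) S (g True) (g False)"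
    unfolding is_coproduct2_def by metis
  then have "\<exists>i. initial C (W i)" using ind source.indecomposable_iff by blast
  then obtain i where "initial C (W i)" by blast
  then have i: "uimage U (W i) (g i) \<subseteq> trivial_pts S" using initial_iff_image_trivial[OF W] by blast
  have "uimage U S \<sigma> \<subseteq> uimage U (B (\<not> i)) (\<beta> (\<not> i))"
  proof
    fix x assume "x \<in> uimage U S \<sigma>"
    then obtain s where s: "s \<in> pts S" "x = act \<sigma> s" by (auto simp: uimage_def)
    have "x \<in> uimage U (B i) (\<beta> i) \<or> x \<in> uimage U (B (\<not> i)) (\<beta> (\<not> i))"
      using D(3) act_in[OF \<sigma> s(1)] s(2) by (cases i) (auto simp: B_def \<beta>_def)
    moreover have "x \<in> trivial_pts X" if "x \<in> uimage U (B i) (\<beta> i)"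
      using that mem[OF s(1)] i act_trivial_iff[OF S s(1)] s(2) by blast
    ultimately show "x \<in> uimage U (B (\<not> i)) (\<beta> (\<not> i))"
      using trivial_pts_subset_uimage[OF subobjectD(1)[OF B]] by blast
  qed
  then show ?thesis by (cases i) (auto simp: B_def \<beta>_def)
qed

lemma indecomposable_nontrivial_pt:
  assumes S: "subobject C A S \<sigma>" and ind: "indecomposable C S"
  obtains x where "x \<in> uimage U S \<sigma>" "x \<notin> trivial_pts A"
proof -
  have "\<not> initial C S" using ind by (simp add: source.indecomposable_iff noninitial_def)
  then show ?thesis using initial_iff_image_trivial[OF S] that by blast
qed

text \<open>In a binary coproduct decomposition of the union, each member of the family lies in one of the
  summands. The common point \<open>x\<close>, being nontrivial, lies in only one summand, so all members choose
  the same one and nothing but trivial points is left for the other.\<close>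

lemma union_indecomposable:
  assumes I: "small \<S> I" "I \<noteq> {}"
    and F: "\<And>i. i \<in> I \<Longrightarrow> subobject C A (F i) (\<mu> i)"
    and ind: "\<And>i. i \<in> I \<Longrightarrow> indecomposable C (F i)"
    and x: "\<And>i. i \<in> I \<Longrightarrow> x \<in> uimage U (F i) (\<mu> i)" "x \<notin> trivial_pts A"
    and T: "is_union C U A I F \<mu> T \<iota>"
  shows "indecomposable C T"
  unfolding source.indecomposable_iff
proof (intro conjI allI impI)
  have \<iota>: "incl_subobject C U A T \<iota>" and T_eq: "pts T = (\<Union>i\<in>I. uimage U (F i) (\<mu> i))"
    using T by (auto simp: is_union_def)
  note T' = incl_subobjectD[OF \<iota>] and \<iota>' = subobjectD(1)[OF incl_subobjectD[OF \<iota>]]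
  have xT: "x \<in> pts T" using I(2) x(1) T_eq by blast
  then have x_nontriv: "x \<notin> trivial_pts T"
    using act_trivial_iff[OF T' xT] act_incl[OF \<iota> xT] x(2) by simp
  show "noninitial C T"
    using initial_iff_trivial[OF subobjectD(4)[OF T']] subobjectD(4)[OF T'] xT x_nontriv
    unfolding noninitial_def by blast
  fix B0 B1 \<beta>0 \<beta>1 assume X: "is_coproduct2 C B0 B1 T \<beta>0 \<beta>1"
  note B = coproduct2_decomposes[OF X]
  have piece: "\<exists>g. subobject C T (F i) g \<and> uimage U (F i) g = uimage U (F i) (\<mu> i)" if i: "i \<in> I" for i
  proof -
    obtain g where g: "subobject C T (F i) g" "\<mu> i = Comp C \<iota> g"
      using subobject_factor[OF F[OF i] T'] uimage_incl[OF \<iota>] T_eq i by blast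
    have "uimage U (F i) (\<mu> i) = act \<iota> ` uimage U (F i) g"
      using uimage_Comp[OF subobjectD(1)[OF g(1)] \<iota>'] g(2) by simp
    also have "\<dots> = uimage U (F i) g"
      using act_incl[OF \<iota>] uimage_subset[OF subobjectD(1)[OF g(1)]] by (force simp: image_iff)
    finally show ?thesis using g(1) by metis
  qed
  have alt: "uimage U (F i) (\<mu> i) \<subseteq> uimage U B0 \<beta>0 \<or> uimage U (F i) (\<mu> i) \<subseteq> uimage U B1 \<beta>1"
    if i: "i \<in> I" for i
    using piece[OF i] indecomposable_in_coproduct2[OF X _ ind[OF i]] by metis
  have "pts T \<subseteq> uimage U B0 \<beta>0 \<or> pts T \<subseteq> uimage U B1 \<beta>1"
  proof (cases "x \<in> uimage U B0 \<beta>0")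
    case True
    then have "x \<notin> uimage U B1 \<beta>1" using B(4) x_nontriv by blast
    then show ?thesis using alt x(1) T_eq by blast
  next
    case False
    then show ?thesis using alt x(1) T_eq by blast
  qed
  then have "uimage U B1 \<beta>1 \<subseteq> trivial_pts T \<or> uimage U B0 \<beta>0 \<subseteq> trivial_pts T"
    using B(3,4) by blast
  then show "initial C B0 \<or> initial C B1"
    using initial_iff_image_trivial[OF B(1)] initial_iff_image_trivial[OF B(2)] by blast
qed


section \<open>Existence of a decomposition\<close>

text \<open>On nontrivial points this is an equivalence relation, the analogue of lying in a common
  connected subset.\<close>

definition linked :: "'o \<Rightarrow> 'u \<Rightarrow> 'u \<Rightarrow> bool" where
  "linked A x y \<longleftrightarrow> (\<exists>S \<sigma>. subobject C A S \<sigma> \<and> indecomposable C S \<and>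
    x \<in> uimage U S \<sigma> \<and> y \<in> uimage U S \<sigma>)"

lemma linked_sym: "linked A x y \<Longrightarrow> linked A y x"
  unfolding linked_def by blast

lemma linked_pts: "linked A x y \<Longrightarrow> y \<in> pts A"
  using uimage_subset subobjectD(1) unfolding linked_def by blast

lemma linked_refl: "noninitial C A \<Longrightarrow> x \<in> pts A \<Longrightarrow> linked A x x"
  using UD6 unfolding linked_def by blast

lemma pts_small: "A \<in> Obj C \<Longrightarrow> X \<subseteq> pts A \<Longrightarrow> X \<in> \<S>"
  using on_obj_in_Obj[of A] universe by (simp add: Set_cat_def set_universe_def)

text \<open>The component of \<open>x\<close> is the union of the indecomposable subobjects through \<open>x\<close>. These need not
  form a small family, so the union is indexed by the points \<open>y\<close> of the component, with one
  indecomposable subobject through \<open>x\<close> and \<open>y\<close> chosen for each.\<close>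

lemma component_ex:
  assumes A: "noninitial C A" and x: "x \<in> pts A" "x \<notin> trivial_pts A"
  shows "\<exists>K \<kappa>. subobject C A K \<kappa> \<and> indecomposable C K \<and> uimage U K \<kappa> = {y. linked A x y}"
proof -
  let ?I = "{y. linked A x y}"
  have AO: "A \<in> Obj C" using A by (simp add: noninitial_def)
  have I: "small \<S> ?I" "?I \<noteq> {}"
    using pts_small[OF AO, of ?I] small_member linked_pts linked_refl[OF A x(1)] by blast+
  have "\<forall>y\<in>?I. \<exists>S \<sigma>. subobject C A S \<sigma> \<and> indecomposable C S \<and> x \<in> uimage U S \<sigma> \<and> y \<in> uimage U S \<sigma>"
    unfolding linked_def by blast
  then obtain F \<mu> where F: "\<And>y. y \<in> ?I \<Longrightarrow> subobject C A (F y) (\<mu> y)"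
    "\<And>y. y \<in> ?I \<Longrightarrow> indecomposable C (F y)" "\<And>y. y \<in> ?I \<Longrightarrow> x \<in> uimage U (F y) (\<mu> y)"
    "\<And>y. y \<in> ?I \<Longrightarrow> y \<in> uimage U (F y) (\<mu> y)"
    by metis
  obtain K \<kappa> where K: "is_union C U A ?I F \<mu> K \<kappa>"
    using small_lattice_ex(2)[OF AO I, of F \<mu>] F(1) by blast
  then have \<kappa>: "incl_subobject C U A K \<kappa>" and "pts K = (\<Union>y\<in>?I. uimage U (F y) (\<mu> y))"
    by (auto simp: is_union_def)
  moreover have "uimage U (F y) (\<mu> y) \<subseteq> ?I" if "y \<in> ?I" for y
    using F(1-3)[OF that] unfolding linked_def by blast
  ultimately have "uimage U K \<kappa> = ?I" using uimage_incl[OF \<kappa>] F(4) by blast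
  moreover have "indecomposable C K" using union_indecomposable[OF I F(1-3) x(2) K] by blast
  ultimately show ?thesis using incl_subobjectD[OF \<kappa>] by blast
qed

lemma linked_trans:
  assumes A: "noninitial C A" and y: "y \<notin> trivial_pts A" and "linked A x y" "linked A y z"
  shows "linked A x z"
proof -
  obtain K \<kappa> where "subobject C A K \<kappa>" "indecomposable C K" "uimage U K \<kappa> = {w. linked A y w}"
    using component_ex[OF A linked_pts[OF assms(3)] y] by blast
  then show ?thesis using assms(4) linked_sym[OF assms(3)] unfolding linked_def[of A x z] by blast
qed

text \<open>The components of nontrivial points, one for each equivalence class, satisfy the covering
  criterion for a coproduct.\<close>

lemma decomposition_ex:
  assumes A: "noninitial C A"
  shows "\<exists>J \<in> \<S>. \<exists>F \<nu>. (\<forall>j\<in>J. indecomposable C (F j)) \<and> is_coproduct C J F A \<nu>"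
proof -
  let ?N = "pts A - trivial_pts A"
  (* r picks one representative from each class, constantly on the class. *)
  define r where "r = (\<lambda>x. SOME y. y \<in> ?N \<and> linked A x y)"
  define J where "J = r ` ?N"
  have r: "r x \<in> ?N \<and> linked A x (r x)" if "x \<in> ?N" for x
    using someI[of "\<lambda>y. y \<in> ?N \<and> linked A x y" x] that linked_refl[OF A] unfolding r_def by blast
  have r_eq: "r x = r y" if "x \<in> ?N" "y \<in> ?N" "linked A x y" for x y
  proof -
    have "linked A x = linked A y"
      using that linked_trans[OF A] linked_sym by blast
    then show ?thesis by (simp add: r_def)
  qed
  have AO: "A \<in> Obj C" using A by (simp add: noninitial_def)
  have J: "J \<subseteq> ?N" using r unfolding J_def by blast
  have rJ: "r j = j" if "j \<in> J" for j
  proof -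
    obtain x where x: "x \<in> ?N" "j = r x" using \<open>j \<in> J\<close> unfolding J_def by blast
    then show ?thesis using r_eq[of x j] r[of x] by simp
  qed
  have J\<S>: "J \<in> \<S>" using pts_small[OF AO] J by blast
  have "\<forall>j\<in>J. \<exists>K \<kappa>. subobject C A K \<kappa> \<and> indecomposable C K \<and> uimage U K \<kappa> = {y. linked A j y}"
    using component_ex[OF A] J by blast
  then obtain K \<kappa> where K: "\<And>j. j \<in> J \<Longrightarrow> subobject C A (K j) (\<kappa> j)"
    "\<And>j. j \<in> J \<Longrightarrow> indecomposable C (K j)"
    "\<And>j. j \<in> J \<Longrightarrow> uimage U (K j) (\<kappa> j) = {y. linked A j y}"
    by metis
  have Jne: "J \<noteq> {}"
    using A initial_iff_trivial[OF AO] unfolding J_def noninitial_def by blast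
  have "is_coproduct C J K A \<kappa>"
  proof (rule coproduct_if_cover[OF small_member[OF J\<S>] Jne K(1)])
    show "pts A \<subseteq> (\<Union>j\<in>J. uimage U (K j) (\<kappa> j))"
    proof
      fix x assume x: "x \<in> pts A"
      show "x \<in> (\<Union>j\<in>J. uimage U (K j) (\<kappa> j))"
      proof (cases "x \<in> trivial_pts A")
        case True
        then show ?thesis using Jne trivial_pts_subset_uimage[OF subobjectD(1)[OF K(1)]] by blast
      next
        case False
        then have "r x \<in> J" "linked A (r x) x" using x r linked_sym unfolding J_def by blast+
        then show ?thesis using K(3) by blast
      qed
    qed
    fix i j assume i: "i \<in> J" and j: "j \<in> J" and "i \<noteq> j"
    show "uimage U (K i) (\<kappa> i) \<inter> uimage U (K j) (\<kappa> j) \<subseteq> trivial_pts A"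
    proof (rule ccontr)
      assume "\<not> ?thesis"
      then obtain w where w: "linked A i w" "linked A j w" "w \<notin> trivial_pts A"
        using K(3) i j by blast
      then have "w \<in> ?N" using linked_pts by blast
      then have "r i = r w" "r j = r w" using r_eq w i j J by blast+
      then show False using rJ i j \<open>i \<noteq> j\<close> by simp
    qed
  qed
  then show ?thesis using J\<S> K(2) by blast
qed


section \<open>Uniqueness of the decomposition\<close>

lemma coproduct_split_off:
  assumes X: "is_coproduct C J F A \<nu>" and J: "J \<in> \<S>" and j: "j \<in> J"
  obtains Q q where "is_coproduct2 C (F j) Q A (\<nu> j) q"
    and "\<And>k. k \<in> J \<Longrightarrow> k \<noteq> j \<Longrightarrow> uimage U (F k) (\<nu> k) \<subseteq> uimage U Q q"
proof -
  have "J - {j} \<in> \<S>" using universe J unfolding set_universe_def by blast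
  then obtain Q \<mu> where Q: "is_coproduct C (J - {j}) F Q \<mu>"
    using small_coproduct_ex[OF small_member] source.is_coproductD(2)[OF X] by blast
  obtain q where q: "q \<in> hom C Q A" "\<And>i. i \<in> J - {j} \<Longrightarrow> Comp C q (\<mu> i) = \<nu> i"
    using source.is_coproduct_arr_ex[OF Q source.is_coproductD(1)[OF X], of \<nu>]
      source.is_coproductD(3)[OF X] by blast
  have "uimage U (F k) (\<nu> k) \<subseteq> uimage U Q q" if "k \<in> J" "k \<noteq> j" for k
  proof -
    have k: "k \<in> J - {j}" using that by simp
    note \<mu> = source.is_coproductD(3)[OF Q k]
    show ?thesis
      using uimage_Comp[OF \<mu> q(1)] q(2)[OF k] uimage_subset[OF \<mu>]
      unfolding uimage_def[of U Q q] by auto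
  qed
  then show ?thesis using that source.is_coproduct2_split[OF X j Q q] by blast
qed

text \<open>Each assertion follows by comparing the piece \<open>j\<close> with the coproduct \<open>Q\<close> of all other pieces.
  The last one says that a piece absorbs every indecomposable subobject that it meets nontrivially.\<close>

lemma coproduct_piece:
  assumes X: "is_coproduct C J F A \<nu>" and J: "J \<in> \<S>" and j: "j \<in> J"
  shows "subobject C A (F j) (\<nu> j)"
    and "k \<in> J \<Longrightarrow> k \<noteq> j \<Longrightarrow> uimage U (F j) (\<nu> j) \<inter> uimage U (F k) (\<nu> k) \<subseteq> trivial_pts A"
    and "subobject C A S \<sigma> \<Longrightarrow> indecomposable C S \<Longrightarrow> x \<in> uimage U S \<sigma> \<Longrightarrow>
      x \<in> uimage U (F j) (\<nu> j) \<Longrightarrow> x \<notin> trivial_pts A \<Longrightarrow> uimage U S \<sigma> \<subseteq> uimage U (F j) (\<nu> j)"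
proof -
  obtain Q q where Q: "is_coproduct2 C (F j) Q A (\<nu> j) q"
    and rest: "\<And>k. k \<in> J \<Longrightarrow> k \<noteq> j \<Longrightarrow> uimage U (F k) (\<nu> k) \<subseteq> uimage U Q q"
    using coproduct_split_off[OF X J j] by blast
  note D = coproduct2_decomposes[OF Q]
  show "subobject C A (F j) (\<nu> j)" by (rule D(1))
  show "uimage U (F j) (\<nu> j) \<inter> uimage U (F k) (\<nu> k) \<subseteq> trivial_pts A" if "k \<in> J" "k \<noteq> j"
    using rest[OF that] D(4) by blast
  show "uimage U S \<sigma> \<subseteq> uimage U (F j) (\<nu> j)"
    if "subobject C A S \<sigma>" "indecomposable C S" "x \<in> uimage U S \<sigma>"
      "x \<in> uimage U (F j) (\<nu> j)" "x \<notin> trivial_pts A"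
    using indecomposable_in_coproduct2[OF Q that(1,2)] that(3-5) D(4) by blast
qed

lemma decomposition_images_inj:
  assumes X: "is_coproduct C J F A \<nu>" and J: "J \<in> \<S>" and F: "\<And>j. j \<in> J \<Longrightarrow> indecomposable C (F j)"
  shows "inj_on (\<lambda>j. uimage U (F j) (\<nu> j)) J"
proof (rule inj_onI, rule ccontr)
  fix i j assume i: "i \<in> J" and j: "j \<in> J" and eq: "uimage U (F i) (\<nu> i) = uimage U (F j) (\<nu> j)"
    and "i \<noteq> j"
  obtain x where "x \<in> uimage U (F i) (\<nu> i)" "x \<notin> trivial_pts A"
    using indecomposable_nontrivial_pt[OF coproduct_piece(1)[OF X J i] F[OF i]] by blast
  then show False using coproduct_piece(2)[OF X J i j] eq \<open>i \<noteq> j\<close> by blast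
qed

text \<open>A piece of the first decomposition shares a nontrivial point with some piece of the second one.
  Both are indecomposable, so each absorbs the other.\<close>

lemma decomposition_images_subset:
  assumes X: "is_coproduct C J F A \<nu>" and J: "J \<in> \<S>" and F: "\<And>j. j \<in> J \<Longrightarrow> indecomposable C (F j)"
    and X': "is_coproduct C J' F' A \<nu>'" and J': "J' \<in> \<S>" "J' \<noteq> {}"
    and F': "\<And>j. j \<in> J' \<Longrightarrow> indecomposable C (F' j)"
  shows "(\<lambda>j. uimage U (F j) (\<nu> j)) ` J \<subseteq> (\<lambda>j. uimage U (F' j) (\<nu>' j)) ` J'"
proof (rule image_subsetI)
  fix j assume j: "j \<in> J"
  note P = coproduct_piece[OF X J j]
  obtain x where x: "x \<in> uimage U (F j) (\<nu> j)" "x \<notin> trivial_pts A"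
    using indecomposable_nontrivial_pt[OF P(1) F[OF j]] by blast
  then have "x \<in> pts A" using uimage_subset[OF subobjectD(1)[OF P(1)]] by blast
  then obtain k where k: "k \<in> J'" "x \<in> uimage U (F' k) (\<nu>' k)"
    using coproduct_cover[OF X' small_member[OF J'(1)] J'(2)] by blast
  note P' = coproduct_piece[OF X' J'(1) k(1)]
  have "uimage U (F j) (\<nu> j) = uimage U (F' k) (\<nu>' k)"
    using P(3)[OF P'(1) F'[OF k(1)] k(2) x] P'(3)[OF P(1) F[OF j] x(1) k(2) x(2)] by blast
  then show "uimage U (F j) (\<nu> j) \<in> (\<lambda>j. uimage U (F' j) (\<nu>' j)) ` J'" using k(1) by blast
qed

lemma decomposition_unique:
  assumes A: "noninitial C A"
    and X: "is_coproduct C J F A \<nu>" "J \<in> \<S>" "\<And>j. j \<in> J \<Longrightarrow> indecomposable C (F j)"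
    and X': "is_coproduct C J' F' A \<nu>'" "J' \<in> \<S>" "\<And>j. j \<in> J' \<Longrightarrow> indecomposable C (F' j)"
  shows "\<exists>b. bij_betw b J J' \<and> (\<forall>j\<in>J. isomorphic C (F j) (F' (b j)))"
proof -
  have ne: "J \<noteq> {}" "J' \<noteq> {}"
    using A X(1) X'(1) source.is_coproduct_empty_initial unfolding noninitial_def by blast+
  let ?im = "\<lambda>j. uimage U (F j) (\<nu> j)" and ?im' = "\<lambda>j. uimage U (F' j) (\<nu>' j)"
  have eq: "?im ` J = ?im' ` J'"
    using decomposition_images_subset[OF X X'(1,2) ne(2) X'(3)]
      decomposition_images_subset[OF X' X(1,2) ne(1) X(3)] by blast
  have bij: "bij_betw ?im J (?im ` J)" "bij_betw ?im' J' (?im ` J)"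
    using decomposition_images_inj[OF X] decomposition_images_inj[OF X'] eq by (auto simp: bij_betw_def)
  define b where "b = inv_into J' ?im' \<circ> ?im"
  have b: "bij_betw b J J'"
    using bij_betw_trans[OF bij(1) bij_betw_inv_into[OF bij(2)]] unfolding b_def .
  moreover have "isomorphic C (F j) (F' (b j))" if j: "j \<in> J" for j
  proof -
    have "?im' (b j) = ?im j" using bij_betw_inv_into_right[OF bij(2)] j unfolding b_def by simp
    moreover have "b j \<in> J'" using b j by (auto simp: bij_betw_def)
    ultimately show ?thesis
      using isomorphic_if_same_image[OF coproduct_piece(1)[OF X(1,2) j] coproduct_piece(1)[OF X'(1,2)]]
      by simp
  qed
  ultimately show ?thesis by blast
qed

end

theorem theorem3p15:
  fixes \<S> :: "'u set set"
    and C :: "('o, 'm) cat"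
    and U :: "('o, 'm, 'u set, 'u set_arrow) ftor"
    and A :: 'o
  assumes "UD_category \<S> C U"
    and "noninitial C A"
  shows "uniquely_decomposable \<S> C A"
proof -
  interpret UD_category \<S> C U by (rule assms(1))
  obtain J F \<nu> where J: "J \<in> \<S>" "\<forall>j\<in>J. indecomposable C (F j)" "is_coproduct C J F A \<nu>"
    using decomposition_ex[OF assms(2)] by blast
  have "A \<in> Obj C" using assms(2) by (simp add: noninitial_def)
  moreover have "iso_to_coproduct C A J F" using J(3) source.iso_to_coproduct_iff by blast
  moreover have "\<exists>b. bij_betw b J J' \<and> (\<forall>j\<in>J. isomorphic C (F j) (F' (b j)))"
    if J': "J' \<in> \<S>" "(\<forall>j\<in>J'. indecomposable C (F' j)) \<and> iso_to_coproduct C A J' F'" for J' F'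
  proof -
    obtain \<nu>' where X': "is_coproduct C J' F' A \<nu>'"
      using J'(2) source.iso_to_coproduct_iff by blast
    show ?thesis using decomposition_unique[OF assms(2) J(3,1) _ X' J'(1)] J(2) J'(2) by blast
  qed
  ultimately show ?thesis
    unfolding uniquely_decomposable_def
    using J(1,2) by (intro conjI bexI[of _ J] exI[of _ F] ballI allI impI) simp_all
qed

end
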